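(* For $i=1,2$, let $U_i\in\mathbb{R}^{n_i\times r_i}_+$ satisfy the SSC and $p_i$-SSC. Then $U_1\otimes U_2\in\mathbb{R}^{n_1n_2\times r_1r_2}$ satisfies the SSC whenever $$1\le\sqrt{\frac{r_1-p_1^2}{p_1^2(r_1-1)}}+\sqrt{\frac{r_2-p_2^2}{p_2^2(r_2-1)}}.$$
   Context: $e$ is the all-ones vector of appropriate dimension, $e_k$ the $k$-th standard basis vector, and $\otimes$ is the Kronecker product of matrices. For $A\in\mathbb{R}^{m\times n}$, $\operatorname{cone}(A)=\{Ay : y\in\mathbb{R}^n, y\ge 0\}$ and $\operatorname{cone}^*(A)=\{y\in\mathbb{R}^m : A^\top y\ge 0\}$. A matrix $H\in\mathbb{R}^{n\times r}_+$ with $r\ge2$ satisfies the sufficiently scattered condition (SSC) if: (SSC1) $\{x\in\mathbb{R}^r_+ : e^\top x\ge\sqrt{r-1}\,\|x\|_2\}\subseteq\operatorname{cone}(H^\top)$; and (SSC2) $\operatorname{cone}^*(H^\top)\cap\operatorname{bd}(\mathcal{C}^* )=\{\lambda e_k : \lambda\ge0,\ k\in\{1,\dots,r\}\}$, where $\mathcal{C}^*=\{x\in\mathbb{R}^r : e^\top x\ge\|x\|_2\}$ and $\operatorname{bd}$ denotes the boundary. For $p\ge1$, a matrix $U\in\mathbb{R}^{n\times r}_+$ with $r\ge2$ satisfies $p$-SSC if $\mathcal{C}_p=\{x\in\mathbb{R}^r_+ : e^\top x\ge p\|x\|_2\}\subseteq\operatorname{cone}(U^\top)$. *)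

theory Defs
  imports "HOL-Analysis.Analysis"
begin

(* A real m x n matrix is an element of real ^ 'n ^ 'm; vec 1 is the all-ones vector e,
   axis k 1 is the standard basis vector e_k, and <= on vectors is componentwise. *)

definition conic_image :: "real ^ 'n ^ 'm \<Rightarrow> (real ^ 'm) set" where
  "conic_image A = {A *v y | y. 0 \<le> y}"

definition dual_cone :: "real ^ 'n ^ 'm \<Rightarrow> (real ^ 'm) set" where
  "dual_cone A = {y. 0 \<le> transpose A *v y}"

definition C_set :: "real \<Rightarrow> (real ^ 'r) set" where
  "C_set p = {x. 0 \<le> x \<and> vec 1 \<bullet> x \<ge> p * norm x}"

definition C_star :: "(real ^ 'r) set" where
  "C_star = {x. vec 1 \<bullet> x \<ge> norm x}"

definition nonneg_matrix :: "real ^ 'r ^ 'n \<Rightarrow> bool" where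
  "nonneg_matrix H \<longleftrightarrow> (\<forall>i j. 0 \<le> H $ i $ j)"

definition SSC1 :: "real ^ 'r ^ 'n \<Rightarrow> bool" where
  "SSC1 H \<longleftrightarrow> C_set (sqrt (real CARD('r) - 1)) \<subseteq> conic_image (transpose H)"

definition SSC2 :: "real ^ 'r ^ 'n \<Rightarrow> bool" where
  "SSC2 H \<longleftrightarrow>
     dual_cone (transpose H) \<inter> frontier C_star = {l *\<^sub>R axis k 1 | l k. 0 \<le> l}"

definition SSC :: "real ^ 'r ^ 'n \<Rightarrow> bool" where
  "SSC H \<longleftrightarrow> 2 \<le> CARD('r) \<and> nonneg_matrix H \<and> SSC1 H \<and> SSC2 H"

definition pSSC :: "real \<Rightarrow> real ^ 'r ^ 'n \<Rightarrow> bool" where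
  "pSSC p U \<longleftrightarrow>
     1 \<le> p \<and> 2 \<le> CARD('r) \<and> nonneg_matrix U \<and> C_set p \<subseteq> conic_image (transpose U)"

(* Rows and columns of the Kronecker product are indexed by pairs; the usual n1 n2 x r1 r2 matrix
   arises by enumerating the pairs lexicographically. *)
definition kronecker :: "real ^ 'r1 ^ 'n1 \<Rightarrow> real ^ 'r2 ^ 'n2 \<Rightarrow> real ^ ('r1 \<times> 'r2) ^ ('n1 \<times> 'n2)"
    (infixl "\<otimes>\<^sub>K" 70) where
  "A \<otimes>\<^sub>K B = (\<chi> i j. A $ fst i $ fst j * B $ snd i $ snd j)"

end

(* For w in the dual cone of the Kronecker product, write s for its sum of entries and f, g for its
   vectors of row and column sums. By p-SSC each cone(U_i^T) contains the standard simplex shrunk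
   about its barycentre by the square root occurring in the hypothesis; by SSC and compactness the
   shrink factors can be taken to be a, b with a + b \<ge> 1 and (a = 1 or a (r1 - 1) > 1), similarly
   for b. Contracting w with the vertices of the second shrunken simplex gives vectors in the dual
   cone of U1, on which norm y \<le> e . y; summing the squares of these inequalities yields
     b^2 r2 (s^2 - |g|^2) \<le> b^2 r2 (s^2 - |w|^2) + (1 - b^2) (s^2 - |f|^2),
   and symmetrically with a, r1. Since (1 - a^2) (1 - b^2) < a^2 r1 b^2 r2, the two inequalities
   force |w| \<le> s, with equality only if |f| = |g| = s; then SSC2 makes w a multiple of a standard
   basis vector. *)
theory Submission
  imports Defs
begin

declare vec_1 [simp del]

section \<open>Inner products with the all-ones vector, and dual cones\<close>

lemma vec1_inner: "vec 1 \<bullet> (y :: real ^ 'r) = (\<Sum>i\<in>UNIV. y $ i)"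
  by (simp add: inner_vec_def)

lemma norm_power2_cart: "(norm (y :: real ^ 'r))\<^sup>2 = (\<Sum>i\<in>UNIV. (y $ i)\<^sup>2)"
  unfolding power2_norm_eq_inner by (simp add: inner_vec_def power2_eq_square)

lemma vec1_inner_vec1: "vec 1 \<bullet> (vec 1 :: real ^ 'r) = real CARD('r)"
  by (simp only: vec1_inner) simp

lemma norm_power2_vec1: "(norm (vec 1 :: real ^ 'r))\<^sup>2 = real CARD('r)"
  by (simp add: norm_power2_cart)

lemma mem_dual_cone_transpose:
  "y \<in> dual_cone (transpose H) \<longleftrightarrow> (\<forall>i. 0 \<le> (\<Sum>j\<in>UNIV. H $ i $ j * y $ j))"
  by (simp add: dual_cone_def less_eq_vec_def matrix_vector_mult_def)

lemma matrix_vector_mult_inner: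
  "(A *v z) \<bullet> (y :: real ^ 'm) = z \<bullet> (transpose A *v y)"
  by (metis dot_lmul_matrix inner_commute transpose_matrix_vector)

lemma conic_image_inner_dual_cone:
  assumes "x \<in> conic_image A" "y \<in> dual_cone A"
  shows "0 \<le> x \<bullet> y"
proof -
  obtain z where z: "x = A *v z" "0 \<le> z"
    using assms(1) by (auto simp: conic_image_def)
  have "0 \<le> z \<bullet> (transpose A *v y)"
    using z(2) assms(2) unfolding dual_cone_def less_eq_vec_def inner_vec_def
    by (auto intro!: sum_nonneg)
  then show ?thesis
    unfolding z(1) by (simp only: matrix_vector_mult_inner)
qed

section \<open>Finitely generated cones and Farkas' lemma\<close>

lemma convex_cone_conic_image: "convex_cone (conic_image A)"
  unfolding convex_cone_iff
proof (intro conjI ballI allI impI)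
  show "0 \<in> conic_image A"
    by (auto simp: conic_image_def intro!: exI[of _ 0])
  show "x + y \<in> conic_image A" if xy: "x \<in> conic_image A" "y \<in> conic_image A" for x y
  proof -
    obtain u v where "x = A *v u" "0 \<le> u" "y = A *v v" "0 \<le> v"
      using xy by (auto simp: conic_image_def)
    then show ?thesis
      by (auto simp: conic_image_def less_eq_vec_def matrix_vector_right_distrib intro!: exI[of _ "u + v"])
  qed
  show "c *\<^sub>R x \<in> conic_image A" if xc: "x \<in> conic_image A" "0 \<le> c" for x and c :: real
  proof -
    obtain u where "x = A *v u" "0 \<le> u"
      using xc(1) unfolding conic_image_def by blast
    then show ?thesis
      using xc(2)
      by (auto simp: conic_image_def less_eq_vec_def matrix_vector_mult_scaleR intro!: exI[of _ "c *\<^sub>R u"])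
  qed
qed

text \<open>The cone generated by the finitely many columns of \<open>A\<close> is closed and
  convex, so a point outside it is strictly separated from it. The separating functional turns out
  to lie in the dual cone and to be negative at \<open>x\<close>.\<close>

lemma farkas:
  fixes A :: "real ^ 'n ^ 'm"
  assumes "\<And>y. y \<in> dual_cone A \<Longrightarrow> 0 \<le> x \<bullet> y"
  shows "x \<in> conic_image A"
proof (rule ccontr)
  assume x: "x \<notin> conic_image A"
  define K where "K = convex_cone hull (range (\<lambda>j. column j A))"
  have col: "column j A \<in> conic_image A" for j
    unfolding conic_image_def
    by (auto simp: less_eq_vec_def axis_def simp flip: matrix_vector_mult_basis)
  have "K \<subseteq> conic_image A"
    unfolding K_def by (rule hull_minimal) (use col convex_cone_conic_image in auto)
  then have "x \<notin> K"
    using x by blast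
  moreover have "convex K" "closed K"
    unfolding K_def by (simp_all add: convex_convex_cone_hull closed_convex_cone_hull)
  ultimately obtain a b where ab: "a \<bullet> x < b" "\<And>z. z \<in> K \<Longrightarrow> a \<bullet> z > b"
    using separating_hyperplane_closed_point[of K x] by blast
  have b: "b < 0"
    using ab(2)[of 0] by (simp add: K_def convex_cone_hull_contains_0)
  have "0 \<le> a \<bullet> column j A" for j
  proof (rule ccontr)
    assume neg: "\<not> 0 \<le> a \<bullet> column j A"
    have "column j A \<in> K"
      unfolding K_def by (rule hull_inc) simp
    \<comment> \<open>The column is rescaled by a positive factor so that \<open>a\<close> takes the
      value \<open>b\<close> on it, against the strict bound on \<open>K\<close>.\<close>
    then have "(b / (a \<bullet> column j A)) *\<^sub>R column j A \<in> K"
      unfolding K_def using b neg by (intro convex_cone_hull_mul) (auto simp: zero_le_divide_iff)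
    from ab(2)[OF this] show False
      using neg by simp
  qed
  then have "a \<in> dual_cone A"
    by (simp add: dual_cone_def less_eq_vec_def matrix_vector_mult_def inner_vec_def column_def
        transpose_def mult.commute)
  with assms[of a] ab(1) b show False
    by (simp add: inner_commute)
qed

section \<open>Duality between \<open>C_set\<close> and \<open>C_star\<close>, and the boundary of
  \<open>C_star\<close>\<close>

lemma norm_power2_centered:
  fixes y :: "real ^ 'r"
  shows "(norm (y - ((vec 1 \<bullet> y) / real CARD('r)) *\<^sub>R vec 1))\<^sup>2
    = (norm y)\<^sup>2 - (vec 1 \<bullet> y)\<^sup>2 / real CARD('r)"
proof -
  show ?thesis
    unfolding power2_norm_eq_inner
    by (simp add: vec1_inner_vec1 inner_diff_left inner_diff_right inner_commute power2_eq_square field_simps)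
qed

text \<open>Split \<open>x\<close> and \<open>w\<close> into a multiple of the all-ones vector and a
  centred part. The cone conditions bound the squared norms of the centred parts by
  \<open>s\<^sup>2 / (r * (r - 1))\<close> and \<open>t\<^sup>2 * (r - 1) / r\<close>. Their product
  is \<open>(s * t / r)\<^sup>2\<close>, so by Cauchy-Schwarz the centred parts cannot outweigh the
  term \<open>s * t / r\<close>.\<close>

lemma C_set_inner_C_star:
  fixes x w :: "real ^ 'r"
  assumes r: "2 \<le> CARD('r)" and x: "x \<in> C_set (sqrt (real CARD('r) - 1))" and w: "w \<in> C_star"
  shows "0 \<le> x \<bullet> w"
proof -
  define r where "r = real CARD('r)"
  define s where "s = vec 1 \<bullet> x"
  define t where "t = vec 1 \<bullet> w"
  define x' where "x' = x - (s / r) *\<^sub>R vec 1"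
  define w' where "w' = w - (t / r) *\<^sub>R vec 1"
  have r2: "2 \<le> r"
    using r by (simp add: r_def)
  have ee: "vec 1 \<bullet> (vec 1 :: real ^ 'r) = r"
    unfolding r_def by (rule vec1_inner_vec1)
  have xs: "sqrt (r - 1) * norm x \<le> s" and wt: "norm w \<le> t"
    using x w by (auto simp: C_set_def C_star_def s_def t_def r_def)
  have s0: "0 \<le> s" and t0: "0 \<le> t"
    using order_trans[OF _ xs, of 0] order_trans[OF norm_ge_zero wt] r2 by auto
  have "(sqrt (r - 1) * norm x)\<^sup>2 \<le> s\<^sup>2"
    using xs r2 by (intro power_mono) auto
  then have 1: "(r - 1) * (norm x)\<^sup>2 \<le> s\<^sup>2"
    using r2 by (simp add: power_mult_distrib)
  have 2: "(norm w)\<^sup>2 \<le> t\<^sup>2"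
    using wt by (intro power_mono) auto
  have nx: "(norm x')\<^sup>2 = (norm x)\<^sup>2 - s\<^sup>2 / r" and nw: "(norm w')\<^sup>2 = (norm w)\<^sup>2 - t\<^sup>2 / r"
    unfolding x'_def w'_def s_def t_def r_def by (rule norm_power2_centered)+
  have "(norm x')\<^sup>2 \<le> s\<^sup>2 / (r * (r - 1))"
  proof -
    have "(norm x)\<^sup>2 \<le> s\<^sup>2 / (r - 1)"
      using 1 r2 by (simp add: pos_le_divide_eq mult.commute)
    also have "\<dots> = s\<^sup>2 / (r * (r - 1)) + s\<^sup>2 / r"
      using r2 by (simp add: divide_simps) (simp add: algebra_simps)
    finally show ?thesis
      unfolding nx by simp
  qed
  moreover have "(norm w')\<^sup>2 \<le> t\<^sup>2 * (r - 1) / r"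
    using 2 r2 unfolding nw by (simp add: field_simps)
  ultimately have "(norm x')\<^sup>2 * (norm w')\<^sup>2 \<le> s\<^sup>2 / (r * (r - 1)) * (t\<^sup>2 * (r - 1) / r)"
    using r2 by (intro mult_mono) auto
  also have "\<dots> = (s * t / r)\<^sup>2"
    using r2 by (simp add: power2_eq_square)
  finally have "norm x' * norm w' \<le> s * t / r"
    using power2_le_imp_le[of "norm x' * norm w'" "s * t / r"] s0 t0 r2
    by (simp add: power_mult_distrib)
  moreover have "x \<bullet> w = x' \<bullet> w' + s * t / r"
    using r2 ee unfolding x'_def w'_def
    by (simp add: inner_diff_left inner_diff_right s_def t_def inner_commute field_simps)
  ultimately show ?thesis
    using Cauchy_Schwarz_ineq2[of x' w'] by linarith
qed

text \<open>Cauchy-Schwarz against \<open>u\<close>, the projection of the basis vector onto the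
  hyperplane orthogonal to the all-ones vector.\<close>

lemma component_le_of_centered:
  fixes v :: "real ^ 'r"
  assumes "vec 1 \<bullet> v = 0"
  shows "(v $ j)\<^sup>2 \<le> (norm v)\<^sup>2 * (1 - 1 / real CARD('r))"
proof -
  define u :: "real ^ 'r" where "u = axis j 1 - (1 / real CARD('r)) *\<^sub>R vec 1"
  have "v $ j = v \<bullet> u"
    using assms by (simp add: u_def inner_diff_right inner_axis inner_commute)
  moreover have "(norm u)\<^sup>2 = 1 - 1 / real CARD('r)"
    using norm_power2_centered[of "axis j 1 :: real ^ 'r"]
    by (simp add: u_def inner_axis inner_commute[of "vec 1"])
  ultimately show ?thesis
    using Cauchy_Schwarz_ineq[of v u] by (simp add: power2_norm_eq_inner)
qed

text \<open>One test vector suffices for each \<open>y\<close>: the point \<open>x\<close> of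
  \<open>C_set\<close> whose centred part is opposite to that of \<open>y\<close>. Expanding
  \<open>0 \<le> x \<bullet> y\<close> bounds the centred part of \<open>y\<close> by its entry
  sum.\<close>

lemma dual_cone_subset_C_star:
  fixes A :: "real ^ 'n ^ 'r"
  assumes r: "2 \<le> CARD('r)" and A: "C_set (sqrt (real CARD('r) - 1)) \<subseteq> conic_image A"
  shows "dual_cone A \<subseteq> C_star"
proof
  fix y assume y: "y \<in> dual_cone A"
  define r where "r = real CARD('r)"
  define s where "s = vec 1 \<bullet> y"
  define v where "v = y - (s / r) *\<^sub>R vec 1"
  \<comment> \<open>This is the largest entry that a centred vector of norm \<open>norm v\<close>
    can have, so \<open>x\<close> is nonnegative. It also gives
    \<open>sqrt (r - 1) * norm x = vec 1 \<bullet> x\<close>, that is, equality in the norm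
    condition of \<open>C_set\<close>.\<close>
  define c where "c = norm v * sqrt ((r - 1) / r)"
  define x where "x = c *\<^sub>R vec 1 - v"
  have r2: "2 \<le> r"
    using r by (simp add: r_def)
  have ee: "vec 1 \<bullet> (vec 1 :: real ^ 'r) = r"
    unfolding r_def by (rule vec1_inner_vec1)
  have nv: "(norm v)\<^sup>2 = (norm y)\<^sup>2 - s\<^sup>2 / r"
    unfolding v_def s_def r_def by (rule norm_power2_centered)
  have ev: "vec 1 \<bullet> v = 0"
    using r2 by (simp add: v_def inner_diff_right ee s_def)
  have c2: "c\<^sup>2 * r = (norm v)\<^sup>2 * (r - 1)" and c0: "0 \<le> c"
    using r2 by (simp_all add: c_def power_mult_distrib)
  have "(norm x)\<^sup>2 = c\<^sup>2 * r + (norm v)\<^sup>2"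
    unfolding x_def power2_norm_eq_inner
    using ev ee by (simp add: inner_diff_left inner_diff_right inner_commute power2_eq_square)
  then have nx: "(norm x)\<^sup>2 = (norm v)\<^sup>2 * r"
    unfolding c2 by (simp add: algebra_simps)
  have "(sqrt (r - 1) * norm x)\<^sup>2 = ((norm v)\<^sup>2 * (r - 1)) * r"
    using r2 by (simp add: power_mult_distrib nx)
  also have "\<dots> = (c * r)\<^sup>2"
    unfolding c2[symmetric] by (simp add: power2_eq_square)
  finally have "(sqrt (r - 1) * norm x)\<^sup>2 = (c * r)\<^sup>2" .
  then have "sqrt (r - 1) * norm x = c * r"
    by (rule power2_eq_imp_eq) (use r2 c0 in simp_all)
  moreover have "vec 1 \<bullet> x = c * r"
    using ev ee by (simp add: x_def inner_diff_right)
  moreover have "0 \<le> x $ j" for j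
  proof -
    have "(v $ j)\<^sup>2 \<le> (norm v)\<^sup>2 * (1 - 1 / r)"
      using component_le_of_centered[OF ev] by (simp add: r_def)
    also have "\<dots> = c\<^sup>2"
      using c2 r2 by (simp add: field_simps)
    finally have "v $ j \<le> c"
      using c0 by (rule power2_le_imp_le)
    then show ?thesis
      by (simp add: x_def)
  qed
  ultimately have "x \<in> C_set (sqrt (real CARD('r) - 1))"
    by (simp add: C_set_def less_eq_vec_def r_def)
  with A y have "0 \<le> x \<bullet> y"
    using conic_image_inner_dual_cone by blast
  moreover have "x \<bullet> y = c * s - (norm v)\<^sup>2"
    using ev by (simp add: x_def s_def v_def inner_diff_left inner_diff_right power2_norm_eq_inner inner_commute)
  ultimately have vs: "(norm v)\<^sup>2 \<le> c * s"
    by simp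
  \<comment> \<open>The all-ones vector is in \<open>C_set\<close>, hence \<open>0 \<le> s\<close>;
    the final passage from squares to \<open>norm y \<le> s\<close> depends on this.\<close>
  have "sqrt (r - 1) * sqrt r \<le> r"
    using r2 by (simp flip: real_sqrt_mult) (rule real_le_lsqrt, simp_all add: power2_eq_square)
  then have "(vec 1 :: real ^ 'r) \<in> C_set (sqrt (real CARD('r) - 1))"
    using norm_power2_vec1[where 'r = 'r]
    by (auto simp: C_set_def less_eq_vec_def vec1_inner_vec1 r_def real_sqrt_unique)
  with A y have "0 \<le> vec 1 \<bullet> y"
    using conic_image_inner_dual_cone by blast
  then have s0: "0 \<le> s"
    by (simp add: s_def)
  have "((norm v)\<^sup>2)\<^sup>2 \<le> (c * s)\<^sup>2"
    using vs by (intro power_mono) auto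
  then have "((norm v)\<^sup>2)\<^sup>2 * r \<le> (c\<^sup>2 * r) * s\<^sup>2"
    using mult_right_mono[of "((norm v)\<^sup>2)\<^sup>2" "(c * s)\<^sup>2" r] r2
    by (simp add: power_mult_distrib mult_ac)
  then have "(norm v)\<^sup>2 * ((norm v)\<^sup>2 * r) \<le> (norm v)\<^sup>2 * ((r - 1) * s\<^sup>2)"
    unfolding c2 by (simp add: power2_eq_square mult_ac)
  then have "(norm v)\<^sup>2 * r \<le> (r - 1) * s\<^sup>2"
  proof (cases "v = 0")
    case False
    then have "0 < (norm v)\<^sup>2"
      by simp
    with \<open>(norm v)\<^sup>2 * ((norm v)\<^sup>2 * r) \<le> (norm v)\<^sup>2 * ((r - 1) * s\<^sup>2)\<close> show ?thesis
      by (rule mult_left_le_imp_le)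
  qed (use r2 in simp)
  then have "(norm y)\<^sup>2 \<le> s\<^sup>2"
    using nv r2 by (simp add: field_simps)
  then have "norm y \<le> s"
    using s0 by (rule power2_le_imp_le)
  then show "y \<in> C_star"
    by (simp add: C_star_def s_def)
qed

text \<open>Moving from \<open>x\<close> by \<open>\<epsilon>\<close> against the all-ones vector
  \<open>e\<close> lowers the entry sum by \<open>\<epsilon>\<close> times the square of
  \<open>norm e\<close>, but the norm by at most \<open>\<epsilon> * norm e\<close>. Since
  \<open>norm e\<close> exceeds 1 in dimension at least two, a point with equality cannot be
  interior.\<close>

lemma frontier_C_star:
  assumes r: "2 \<le> CARD('r)"
  shows "frontier (C_star :: (real ^ 'r) set) = {x. vec 1 \<bullet> x = norm x}"
proof -
  let ?e = "vec 1 :: real ^ 'r"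
  have cl: "closed (C_star :: (real ^ 'r) set)"
    unfolding C_star_def by (intro closed_Collect_le continuous_intros)
  have "interior (C_star :: (real ^ 'r) set) = {x. norm x < ?e \<bullet> x}"
  proof (rule interior_unique)
    show "{x. norm x < ?e \<bullet> x} \<subseteq> C_star"
      by (auto simp: C_star_def)
    show "open {x. norm x < ?e \<bullet> x}"
      by (intro open_Collect_less continuous_intros)
    fix T assume T: "T \<subseteq> (C_star :: (real ^ 'r) set)" "open T"
    show "T \<subseteq> {x. norm x < ?e \<bullet> x}"
    proof
      fix x assume "x \<in> T"
      then obtain d where d: "0 < d" "ball x d \<subseteq> C_star"
        using T unfolding open_contains_ball by blast
      define \<epsilon> where "\<epsilon> = d / (2 * norm ?e)"
      have ne: "1 < norm ?e"
        by (rule power2_less_imp_less) (use norm_power2_vec1[where 'r = 'r] r in simp_all)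
      have "norm (\<epsilon> *\<^sub>R ?e) = d / 2"
        using ne d by (auto simp: \<epsilon>_def)
      then have "x - \<epsilon> *\<^sub>R ?e \<in> ball x d"
        using d by (simp add: dist_norm)
      then have "norm (x - \<epsilon> *\<^sub>R ?e) \<le> ?e \<bullet> (x - \<epsilon> *\<^sub>R ?e)"
        using d unfolding C_star_def by blast
      also have "\<dots> = ?e \<bullet> x - \<epsilon> * (norm ?e)\<^sup>2"
        by (simp add: inner_diff_right power2_norm_eq_inner)
      finally have "norm (x - \<epsilon> *\<^sub>R ?e) \<le> ?e \<bullet> x - \<epsilon> * (norm ?e)\<^sup>2" .
      moreover have "norm x \<le> norm (x - \<epsilon> *\<^sub>R ?e) + \<epsilon> * norm ?e"
        using norm_triangle_ineq[of "x - \<epsilon> *\<^sub>R ?e" "\<epsilon> *\<^sub>R ?e"] d ne by (simp add: \<epsilon>_def)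
      moreover have "\<epsilon> * norm ?e < \<epsilon> * (norm ?e)\<^sup>2"
        using ne d by (auto simp: \<epsilon>_def power2_eq_square)
      ultimately show "x \<in> {x. norm x < ?e \<bullet> x}"
        by simp
    qed
  qed
  then show ?thesis
    using cl by (auto simp: frontier_def C_star_def)
qed

(* Dually: the standard simplex, shrunk by the factor a about its barycentre, lies in the cone
   of which D is the dual. *)
definition shrunk_simplex_bound :: "real \<Rightarrow> (real ^ 'r) set \<Rightarrow> bool" where
  "shrunk_simplex_bound a D \<longleftrightarrow>
     (\<forall>y\<in>D. \<forall>k. 0 \<le> (1 - a) / real CARD('r) * (vec 1 \<bullet> y) + a * y $ k)"

section \<open>Shrink factors obtained from p-SSC\<close>

lemma pSSC_shrink_factor_le_1:
  fixes U :: "real ^ 'r ^ 'n"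
  assumes U: "pSSC p U"
  shows "sqrt ((real CARD('r) - p\<^sup>2) / (p\<^sup>2 * (real CARD('r) - 1))) \<le> 1"
proof -
  have r: "2 \<le> real CARD('r)" and p: "1 \<le> p\<^sup>2"
    using U by (auto simp: pSSC_def)
  then have "0 < p\<^sup>2 * (real CARD('r) - 1)"
    by (intro mult_pos_pos) auto
  moreover have "real CARD('r) - p\<^sup>2 \<le> p\<^sup>2 * (real CARD('r) - 1)"
    using mult_right_mono[OF p, of "real CARD('r)"] by (simp add: algebra_simps)
  ultimately show ?thesis
    by (simp only: real_sqrt_le_1_iff divide_le_eq_1_pos)
qed

(* Isabelle's sqrt is odd, so the hypothesis excludes p^2 > r. *)
lemma pSSC_power2_le_card:
  fixes U :: "real ^ 'r ^ 'n"
  assumes U: "pSSC p U"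
    and "0 \<le> sqrt ((real CARD('r) - p\<^sup>2) / (p\<^sup>2 * (real CARD('r) - 1)))"
  shows "p\<^sup>2 \<le> real CARD('r)"
proof -
  have "0 < p\<^sup>2 * (real CARD('r) - 1)"
    using U by (intro mult_pos_pos) (auto simp: pSSC_def)
  moreover have "0 \<le> (real CARD('r) - p\<^sup>2) / (p\<^sup>2 * (real CARD('r) - 1))"
    using assms(2) by (simp only: real_sqrt_ge_0_iff)
  ultimately show ?thesis
    by (simp only: zero_le_divide_iff) linarith
qed

text \<open>With this \<open>a\<close> the vertices of the shrunken simplex, which have entry sum 1,
  satisfy \<open>p * norm x = 1\<close>. They therefore belong to \<open>C_set p\<close>, hence to
  the cone of \<open>U\<close>, and pair nonnegatively with the dual cone.\<close>

lemma shrunk_simplex_bound_pSSC: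
  fixes U :: "real ^ 'r ^ 'n"
  assumes U: "pSSC p U" and p: "p\<^sup>2 \<le> real CARD('r)"
  defines "a \<equiv> sqrt ((real CARD('r) - p\<^sup>2) / (p\<^sup>2 * (real CARD('r) - 1)))"
  shows "shrunk_simplex_bound a (dual_cone (transpose U))"
proof -
  define r where "r = real CARD('r)"
  have r2: "2 \<le> r" and p1: "1 \<le> p"
    using U by (auto simp: pSSC_def r_def)
  have a0: "0 \<le> a"
    using p r2 by (simp add: a_def r_def)
  have a2: "a\<^sup>2 = (r - p\<^sup>2) / (p\<^sup>2 * (r - 1))"
    using p r2 by (simp add: a_def r_def)
  have a1: "a \<le> 1"
    unfolding a_def by (rule pSSC_shrink_factor_le_1[OF U])
  show "shrunk_simplex_bound a (dual_cone (transpose U))"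
    unfolding shrunk_simplex_bound_def
  proof (intro ballI allI)
    fix y k assume y: "y \<in> dual_cone (transpose U)"
    define x :: "real ^ 'r" where "x = ((1 - a) / r) *\<^sub>R vec 1 + a *\<^sub>R axis k 1"
    have ex: "vec 1 \<bullet> x = 1"
      using r2 by (simp add: x_def inner_add_right vec1_inner_vec1 inner_axis r_def)
    have "(norm x)\<^sup>2 = ((1 - a) / r)\<^sup>2 * r + 2 * a * ((1 - a) / r) + a\<^sup>2"
      unfolding power2_norm_eq_inner
      by (simp add: x_def inner_add_right inner_add_left vec1_inner_vec1 inner_axis inner_axis' r_def
          power2_eq_square) (simp add: field_simps)
    also have "\<dots> = (1 + a\<^sup>2 * (r - 1)) / r"
      using r2 by (simp add: field_simps power2_eq_square)
    also have "a\<^sup>2 * (r - 1) = (r - p\<^sup>2) / p\<^sup>2"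
      using r2 by (simp add: a2)
    also have "(1 + (r - p\<^sup>2) / p\<^sup>2) / r = 1 / p\<^sup>2"
      using r2 p1 by (simp add: field_simps)
    finally have "(p * norm x)\<^sup>2 = 1\<^sup>2"
      using p1 by (simp add: power_mult_distrib)
    then have "p * norm x = 1"
      by (rule power2_eq_imp_eq) (use p1 in simp_all)
    moreover have "0 \<le> x $ j" for j
      using a0 a1 r2 by (simp add: x_def axis_def)
    ultimately have "x \<in> C_set p"
      by (simp add: C_set_def less_eq_vec_def ex)
    then have "0 \<le> x \<bullet> y"
      using U y conic_image_inner_dual_cone unfolding pSSC_def by blast
    then show "0 \<le> (1 - a) / real CARD('r) * (vec 1 \<bullet> y) + a * y $ k"
      by (simp add: x_def inner_add_left inner_axis' r_def)
  qed
qed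

section \<open>Consequences of the SSC for the dual cone; improving the shrink factor\<close>

lemma SSC_imp_pSSC:
  fixes U :: "real ^ 'r ^ 'n"
  assumes "SSC U"
  shows "pSSC (sqrt (real CARD('r) - 1)) U"
  using assms by (auto simp: SSC_def pSSC_def SSC1_def)

lemma SSC_dual_cone_norm_le:
  fixes U :: "real ^ 'r ^ 'n"
  assumes "SSC U" "y \<in> dual_cone (transpose U)"
  shows "norm y \<le> vec 1 \<bullet> y"
  using assms dual_cone_subset_C_star[of "transpose U"] by (auto simp: SSC_def SSC1_def C_star_def)

lemma SSC_dual_cone_norm_eq:
  fixes U :: "real ^ 'r ^ 'n"
  assumes "SSC U" "y \<in> dual_cone (transpose U)" "norm y = vec 1 \<bullet> y"
  obtains l k where "0 \<le> l" "y = l *\<^sub>R axis k 1"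
proof -
  have "y \<in> dual_cone (transpose U) \<inter> frontier C_star"
    using assms frontier_C_star[where 'r = 'r] by (simp add: SSC_def)
  then show ?thesis
    using assms(1) that unfolding SSC_def SSC2_def by blast
qed

lemma closed_dual_cone: "closed (dual_cone A)"
  unfolding dual_cone_def less_eq_vec_def matrix_vector_mult_def
  by (intro closed_Collect_all closed_Collect_le) (auto intro!: continuous_intros)

lemma scaleR_dual_cone:
  assumes "y \<in> dual_cone A" "0 \<le> c"
  shows "c *\<^sub>R y \<in> dual_cone A"
  using assms by (auto simp: dual_cone_def less_eq_vec_def matrix_vector_mult_scaleR simp del: transpose_matrix_vector)

text \<open>On the slice with entry sum 1, \<open>norm y \<le> 1\<close> alone gives the weak
  inequality, with equality possible only when \<open>norm y = 1\<close>. By SSC2 a dual cone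
  element of norm 1 in the slice is a multiple of a basis vector and has no negative entry.\<close>

lemma SSC_component_gt:
  fixes U :: "real ^ 'r ^ 'n"
  assumes U: "SSC U" and r: "3 \<le> CARD('r)"
    and y: "y \<in> dual_cone (transpose U)" and ey: "vec 1 \<bullet> y = 1"
  shows "2 / real CARD('r) - 1 < y $ k"
proof (cases "0 \<le> y $ k")
  case True
  have "2 / real CARD('r) - 1 < 0"
    using r by (simp add: field_simps)
  with True show ?thesis
    by linarith
next
  case False
  define r where "r = real CARD('r)"
  have r3: "3 \<le> r"
    using r by (simp add: r_def)
  have "norm y \<noteq> 1"
  proof
    assume "norm y = 1"
    then obtain l j where "0 \<le> l" "y = l *\<^sub>R axis j 1"
      using SSC_dual_cone_norm_eq[OF U y] ey by metis
    then show False
      using False by (simp add: axis_def split: if_splits)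
  qed
  then have "norm y < 1"
    using SSC_dual_cone_norm_le[OF U y] ey by simp
  then have ny: "(norm y)\<^sup>2 < 1"
    by (simp add: power_less_one_iff)
  define v where "v = y - (1 / r) *\<^sub>R vec 1"
  have "(v $ k)\<^sup>2 \<le> (norm v)\<^sup>2 * (1 - 1 / r)"
    unfolding r_def
    by (rule component_le_of_centered) (simp add: v_def inner_diff_right ey vec1_inner_vec1 r_def)
  also have "(norm v)\<^sup>2 = (norm y)\<^sup>2 - 1 / r"
    using norm_power2_centered[of y] by (simp add: v_def r_def ey)
  also have "((norm y)\<^sup>2 - 1 / r) * (1 - 1 / r) < (1 - 1 / r) * (1 - 1 / r)"
    using ny r3 by (intro mult_strict_right_mono) auto
  finally have "\<bar>v $ k\<bar>\<^sup>2 < (1 - 1 / r)\<^sup>2"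
    by (simp add: power2_eq_square)
  then have "\<bar>v $ k\<bar> < 1 - 1 / r"
    by (rule power2_less_imp_less) (use r3 in simp)
  then show ?thesis
    by (simp add: v_def r_def)
qed

text \<open>SSC1 alone yields the factor \<open>1 / (r - 1)\<close>. The strict entry bound from
  SSC2 becomes uniform because the slice of the dual cone with entry sum 1 is compact, and this
  makes the factor strictly larger when \<open>r\<close> is at least 3.\<close>

lemma SSC_shrunk_simplex_bound:
  fixes U :: "real ^ 'r ^ 'n"
  assumes U: "SSC U"
  obtains a where "0 < a" "a \<le> 1" "a = 1 \<or> 1 < a * (real CARD('r) - 1)"
    "shrunk_simplex_bound a (dual_cone (transpose U))"
proof (cases "CARD('r) = 2")
  case True
  \<comment> \<open>For two columns the SSC is p-SSC with \<open>p = 1\<close>, whose shrink factor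
    is 1.\<close>
  then show ?thesis
    using shrunk_simplex_bound_pSSC[OF SSC_imp_pSSC[OF U]] by (intro that[of 1]) auto
next
  case False
  then have r: "3 \<le> CARD('r)"
    using U by (auto simp: SSC_def)
  define r where "r = real CARD('r)"
  have r3: "3 \<le> r"
    using r by (simp add: r_def)
  define D where "D = dual_cone (transpose U)"
  define S where "S = D \<inter> {y. vec 1 \<bullet> y = 1}"
  have "bounded S"
    using SSC_dual_cone_norm_le[OF U] by (fastforce simp: bounded_iff S_def D_def intro: exI[of _ 1])
  moreover have "closed S"
    unfolding S_def D_def
    by (intro closed_Int closed_dual_cone closed_Collect_eq continuous_intros)
  ultimately have S: "compact S"
    by (simp add: compact_eq_bounded_closed)
  \<comment> \<open>Capping the lower bound at 0 ensures \<open>a \<le> 1\<close> below; 0 also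
    serves as the bound if the slice is empty.\<close>
  have "\<exists>m\<le>0. 2 / r - 1 < m \<and> (\<forall>y\<in>S. m \<le> y $ k)" for k
  proof (cases "S = {}")
    case True
    then show ?thesis
      using r3 by (intro exI[of _ 0]) (simp add: field_simps)
  next
    case False
    then obtain z where z: "z \<in> S" "\<forall>y\<in>S. z $ k \<le> y $ k"
      using continuous_attains_inf[OF S False, of "\<lambda>y. y $ k"] continuous_on_component[OF continuous_on_id]
      by blast
    then have "2 / r - 1 < z $ k"
      using SSC_component_gt[OF U r] by (simp add: S_def D_def r_def)
    then show ?thesis
      using z r3 by (intro exI[of _ "min 0 (z $ k)"]) (auto simp: min_le_iff_disj field_simps)
  qed
  then obtain m where m: "\<And>k. m k \<le> 0" "\<And>k. 2 / r - 1 < m k" "\<And>k y. y \<in> S \<Longrightarrow> m k \<le> y $ k"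
    by metis
  define M where "M = Min (range m)"
  have "M \<in> range m"
    unfolding M_def by (intro Min_in) auto
  then have M: "M \<le> 0" "2 / r - 1 < M"
    using m by auto
  have Mm: "M \<le> m k" for k
    unfolding M_def by (intro Min_le) auto
  \<comment> \<open>The solution of \<open>(1 - a) / r + a * M = 0\<close>: the shrunken entry
    vanishes in the worst case. The bound \<open>2 / r - 1 < M\<close> is equivalent to
    \<open>1 < a * (r - 1)\<close>.\<close>
  define a where "a = 1 / (1 - r * M)"
  have rM: "r * M \<le> 0" "2 - r < r * M"
    using M r3 mult_nonneg_nonpos[of r M] by (auto simp: field_simps)
  have a: "0 < a" "a \<le> 1" "1 < a * (r - 1)"
    using rM by (simp_all add: a_def divide_simps)
  have aM: "(1 - a) / r + a * M = 0"
  proof -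
    have "a * (1 - r * M) = 1"
      using rM by (simp add: a_def)
    then show ?thesis
      using r3 by (simp add: field_simps)
  qed
  show thesis
  proof (rule that[OF a(1,2)])
    show "a = 1 \<or> 1 < a * (real CARD('r) - 1)"
      using a by (simp add: r_def)
    show "shrunk_simplex_bound a (dual_cone (transpose U))"
      unfolding shrunk_simplex_bound_def
    proof (intro ballI allI)
      fix y k assume y: "y \<in> dual_cone (transpose U)"
      define s where "s = vec 1 \<bullet> y"
      have ny: "norm y \<le> s"
        using SSC_dual_cone_norm_le[OF U y] by (simp add: s_def)
      have "s * M \<le> y $ k"
      proof (cases "s = 0")
        case True
        then show ?thesis
          using ny by simp
      next
        case False
        then have s: "0 < s"
          using ny norm_ge_zero[of y] by linarith
        then have "(1 / s) *\<^sub>R y \<in> S"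
          using scaleR_dual_cone[OF y, of "1 / s"] by (simp add: S_def D_def s_def)
        then have "M \<le> y $ k / s"
          using m(3)[of _ k] Mm[of k] by fastforce
        then show ?thesis
          using s by (simp add: field_simps)
      qed
      then have "a * (s * M) \<le> a * y $ k"
        using a by simp
      moreover have "(1 - a) / r * s + a * (s * M) = 0"
        using aM by (metis (no_types) distrib_right mult.assoc mult.commute mult_zero_left)
      ultimately show "0 \<le> (1 - a) / real CARD('r) * (vec 1 \<bullet> y) + a * y $ k"
        by (simp add: s_def r_def)
    qed
  qed
qed

text \<open>The larger of the p-SSC factor and the SSC factor has all the properties. If the former
  is strictly larger, the latter is below 1, so its lower bound \<open>1 < c * (r - 1)\<close>
  carries over.\<close>

lemma SSC_pSSC_shrunk_simplex_bound:
  fixes U :: "real ^ 'r ^ 'n"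
  assumes U: "SSC U" "pSSC p U" and p: "p\<^sup>2 \<le> real CARD('r)"
  obtains a where "0 < a" "a \<le> 1" "a = 1 \<or> 1 < a * (real CARD('r) - 1)"
    "sqrt ((real CARD('r) - p\<^sup>2) / (p\<^sup>2 * (real CARD('r) - 1))) \<le> a"
    "shrunk_simplex_bound a (dual_cone (transpose U))"
proof -
  define a where "a = sqrt ((real CARD('r) - p\<^sup>2) / (p\<^sup>2 * (real CARD('r) - 1)))"
  have a: "a \<le> 1" "shrunk_simplex_bound a (dual_cone (transpose U))"
    unfolding a_def by (rule pSSC_shrink_factor_le_1[OF U(2)], rule shrunk_simplex_bound_pSSC[OF U(2) p])
  obtain c where c: "0 < c" "c \<le> 1" "c = 1 \<or> 1 < c * (real CARD('r) - 1)"
    "shrunk_simplex_bound c (dual_cone (transpose U))"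
    using SSC_shrunk_simplex_bound[OF U(1)] .
  show thesis
  proof (cases "a \<le> c")
    case True
    then show ?thesis
      using that[of c] c by (simp add: a_def)
  next
    case False
    have "2 \<le> CARD('r)"
      using U by (simp add: SSC_def)
    then have "c * (real CARD('r) - 1) \<le> a * (real CARD('r) - 1)"
      using False by (intro mult_right_mono) auto
    then have "1 < a * (real CARD('r) - 1)"
      using a(1) c False by auto
    then show ?thesis
      using a(1) c(1) False by (intro that[OF _ a(1) _ _ a(2)]) (auto simp flip: a_def)
  qed
qed

section \<open>Contractions of elements of the Kronecker dual cone\<close>

text \<open>Shrinking keeps the mean of \<open>h\<close> and scales the deviations from it by
  \<open>b\<close>; mean and deviations are orthogonal.\<close>

lemma sum_shrunk_power2:
  fixes h :: "'r::finite \<Rightarrow> real"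
  shows "(\<Sum>l\<in>UNIV. ((1 - b) / real CARD('r) * sum h UNIV + b * h l)\<^sup>2)
    = (1 - b\<^sup>2) / real CARD('r) * (sum h UNIV)\<^sup>2 + b\<^sup>2 * (\<Sum>l\<in>UNIV. (h l)\<^sup>2)"
proof -
  define F where "F = sum h UNIV"
  define c where "c = (1 - b) / real CARD('r)"
  have "(\<Sum>l\<in>UNIV. (c * F + b * h l)\<^sup>2)
      = (\<Sum>l\<in>UNIV. (c * F)\<^sup>2 + 2 * (c * F) * b * h l + b\<^sup>2 * (h l)\<^sup>2)"
    by (simp add: power2_eq_square algebra_simps)
  also have "\<dots> = real CARD('r) * (c * F)\<^sup>2 + 2 * (c * F) * b * F + b\<^sup>2 * (\<Sum>l\<in>UNIV. (h l)\<^sup>2)"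
    by (simp add: sum.distrib flip: sum_distrib_left F_def)
  also have "real CARD('r) * (c * F)\<^sup>2 + 2 * (c * F) * b * F = (1 - b\<^sup>2) / real CARD('r) * F\<^sup>2"
    by (simp add: c_def field_simps power2_eq_square)
  finally show ?thesis
    by (simp add: F_def c_def)
qed

text \<open>Read \<open>w\<close> as an \<open>r1\<close> by \<open>r2\<close> matrix
  \<open>W\<close>; membership in the dual cone says that \<open>U1 W U2^T\<close> is entrywise
  nonnegative. Contracting \<open>W\<close> with a row of \<open>U1\<close> thus lands in the dual
  cone of \<open>U2\<close>, where \<open>z\<close> is nonnegative, and the two contractions
  commute.\<close>

lemma kronecker_dual_cone_combine:
  fixes U1 :: "real ^ 'r1 ^ 'n1" and U2 :: "real ^ 'r2 ^ 'n2"
  assumes w: "w \<in> dual_cone (transpose (U1 \<otimes>\<^sub>K U2))"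
    and z: "\<And>y. y \<in> dual_cone (transpose U2) \<Longrightarrow> 0 \<le> (\<Sum>l\<in>UNIV. z l * y $ l)"
  shows "(\<chi> k. \<Sum>l\<in>UNIV. z l * w $ (k, l)) \<in> dual_cone (transpose U1)"
  unfolding mem_dual_cone_transpose
proof
  fix i
  define y :: "real ^ 'r2" where "y = (\<chi> l. \<Sum>k\<in>UNIV. U1 $ i $ k * w $ (k, l))"
  have "y \<in> dual_cone (transpose U2)"
    unfolding mem_dual_cone_transpose
  proof
    fix j
    have "0 \<le> (\<Sum>p\<in>UNIV. (U1 \<otimes>\<^sub>K U2) $ (i, j) $ p * w $ p)"
      using w unfolding mem_dual_cone_transpose by blast
    also have "\<dots> = (\<Sum>k\<in>UNIV. \<Sum>l\<in>UNIV. U1 $ i $ k * U2 $ j $ l * w $ (k, l))"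
      by (simp add: kronecker_def sum.cartesian_product case_prod_unfold flip: UNIV_Times_UNIV)
    also have "\<dots> = (\<Sum>l\<in>UNIV. \<Sum>k\<in>UNIV. U1 $ i $ k * U2 $ j $ l * w $ (k, l))"
      by (rule sum.swap)
    also have "\<dots> = (\<Sum>l\<in>UNIV. U2 $ j $ l * y $ l)"
      by (simp add: y_def sum_distrib_left mult_ac)
    finally show "0 \<le> (\<Sum>l\<in>UNIV. U2 $ j $ l * y $ l)" .
  qed
  from z[OF this] have "0 \<le> (\<Sum>l\<in>UNIV. z l * y $ l)" .
  also have "\<dots> = (\<Sum>l\<in>UNIV. \<Sum>k\<in>UNIV. U1 $ i $ k * (z l * w $ (k, l)))"
    by (simp add: y_def sum_distrib_left mult_ac)
  also have "\<dots> = (\<Sum>k\<in>UNIV. \<Sum>l\<in>UNIV. U1 $ i $ k * (z l * w $ (k, l)))"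
    by (rule sum.swap)
  also have "\<dots> = (\<Sum>k\<in>UNIV. U1 $ i $ k * (\<chi> k. \<Sum>l\<in>UNIV. z l * w $ (k, l)) $ k)"
    by (simp add: sum_distrib_left)
  finally show "0 \<le> (\<Sum>k\<in>UNIV. U1 $ i $ k * (\<chi> k. \<Sum>l\<in>UNIV. z l * w $ (k, l)) $ k)" .
qed

text \<open>This is the vector f of the overview; g is
  \<open>row_sums (swap_index w)\<close>.\<close>

definition row_sums :: "real ^ ('a::finite \<times> 'b::finite) \<Rightarrow> real ^ 'a" where
  "row_sums w = (\<chi> k. \<Sum>l\<in>UNIV. w $ (k, l))"

text \<open>Transposition of \<open>w\<close> read as a matrix. It exchanges the two Kronecker
  factors, so that each estimate is proved for one side only.\<close>

definition swap_index :: "real ^ ('a::finite \<times> 'b::finite) \<Rightarrow> real ^ ('b::finite \<times> 'a::finite)" where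
  "swap_index w = (\<chi> q. w $ prod.swap q)"

lemma vec1_inner_prod:
  "vec 1 \<bullet> (w :: real ^ ('a::finite \<times> 'b::finite)) = (\<Sum>k\<in>UNIV. \<Sum>l\<in>UNIV. w $ (k, l))"
  by (simp add: vec1_inner sum.cartesian_product case_prod_unfold flip: UNIV_Times_UNIV)

lemma norm_power2_prod:
  "(norm (w :: real ^ ('a::finite \<times> 'b::finite)))\<^sup>2 = (\<Sum>k\<in>UNIV. \<Sum>l\<in>UNIV. (w $ (k, l))\<^sup>2)"
  by (simp add: norm_power2_cart sum.cartesian_product case_prod_unfold flip: UNIV_Times_UNIV)

lemma vec1_inner_row_sums:
  "vec 1 \<bullet> row_sums (w :: real ^ ('a::finite \<times> 'b::finite)) = vec 1 \<bullet> w"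
  by (simp add: vec1_inner_prod vec1_inner[where 'r = 'a] row_sums_def)

lemma vec1_inner_swap_index: "vec 1 \<bullet> swap_index w = vec 1 \<bullet> w"
  unfolding vec1_inner_prod swap_index_def by (subst sum.swap) simp

lemma norm_swap_index: "norm (swap_index w) = norm w"
proof -
  have "(norm (swap_index w))\<^sup>2 = (norm w)\<^sup>2"
    unfolding norm_power2_prod swap_index_def by (subst sum.swap) simp
  then show ?thesis
    by simp
qed

lemma row_sums_swap_index: "row_sums (swap_index w) = (\<chi> l. \<Sum>k\<in>UNIV. w $ (k, l))"
  by (simp add: row_sums_def swap_index_def)

lemma swap_index_dual_cone:
  fixes U1 :: "real ^ 'r1 ^ 'n1" and U2 :: "real ^ 'r2 ^ 'n2"
  assumes "w \<in> dual_cone (transpose (U1 \<otimes>\<^sub>K U2))"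
  shows "swap_index w \<in> dual_cone (transpose (U2 \<otimes>\<^sub>K U1))"
  unfolding mem_dual_cone_transpose
proof
  fix i :: "'n2 \<times> 'n1"
  have "0 \<le> (\<Sum>p\<in>UNIV. (U1 \<otimes>\<^sub>K U2) $ prod.swap i $ p * w $ p)"
    using assms unfolding mem_dual_cone_transpose by blast
  also have "\<dots> = (\<Sum>q\<in>UNIV. (U1 \<otimes>\<^sub>K U2) $ prod.swap i $ prod.swap q * w $ prod.swap q)"
    by (rule sum.reindex_bij_betw[symmetric]) (rule bij_swap)
  also have "\<dots> = (\<Sum>q\<in>UNIV. (U2 \<otimes>\<^sub>K U1) $ i $ q * swap_index w $ q)"
    by (simp add: kronecker_def swap_index_def mult_ac)
  finally show "0 \<le> (\<Sum>q\<in>UNIV. (U2 \<otimes>\<^sub>K U1) $ i $ q * swap_index w $ q)" .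
qed

text \<open>Contraction with the all-ones vector, which is nonnegative on the dual cone of
  \<open>U2\<close> because entry sums there dominate norms.\<close>

lemma row_sums_dual_cone:
  fixes U1 :: "real ^ 'r1 ^ 'n1" and U2 :: "real ^ 'r2 ^ 'n2"
  assumes "w \<in> dual_cone (transpose (U1 \<otimes>\<^sub>K U2))" and U2: "SSC U2"
  shows "row_sums w \<in> dual_cone (transpose U1)"
proof -
  have "0 \<le> (\<Sum>l\<in>UNIV. 1 * y $ l)" if "y \<in> dual_cone (transpose U2)" for y
    using order_trans[OF norm_ge_zero SSC_dual_cone_norm_le[OF U2 that]] by (simp add: vec1_inner)
  from kronecker_dual_cone_combine[OF assms(1), of "\<lambda>_. 1", OF this] show ?thesis
    by (simp add: row_sums_def)
qed

text \<open>The contraction of \<open>w\<close> with vertex \<open>l\<close> of the shrunken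
  simplex: column \<open>l\<close> moved towards the mean column.\<close>

definition shrunk_column :: "real \<Rightarrow> real ^ ('a::finite \<times> 'b::finite) \<Rightarrow> 'b \<Rightarrow> real ^ 'a" where
  "shrunk_column b w l = (\<chi> k. (1 - b) / real CARD('b) * row_sums w $ k + b * w $ (k, l))"

lemma shrunk_column_dual_cone:
  fixes U1 :: "real ^ 'r1 ^ 'n1" and U2 :: "real ^ 'r2 ^ 'n2"
  assumes w: "w \<in> dual_cone (transpose (U1 \<otimes>\<^sub>K U2))"
    and b: "shrunk_simplex_bound b (dual_cone (transpose U2))"
  shows "shrunk_column b w l \<in> dual_cone (transpose U1)"
proof -
  define c where "c = (1 - b) / real CARD('r2)"
  define z where "z = (\<lambda>l'. c + (if l' = l then b else 0))"
  have z: "(\<Sum>l'\<in>UNIV. z l' * h l') = c * sum h UNIV + b * h l" for h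
    by (simp add: z_def distrib_right sum.distrib if_distrib[of "\<lambda>x. x * _"] flip: sum_distrib_left cong: if_cong)
  have "0 \<le> (\<Sum>l'\<in>UNIV. z l' * y $ l')" if "y \<in> dual_cone (transpose U2)" for y
    using b that by (simp add: shrunk_simplex_bound_def z vec1_inner c_def)
  from kronecker_dual_cone_combine[OF w, of z, OF this] show ?thesis
    by (simp add: z shrunk_column_def row_sums_def c_def)
qed

lemma sum_norm_shrunk_column:
  fixes w :: "real ^ ('a::finite \<times> 'b::finite)"
  shows "(\<Sum>l\<in>UNIV. (norm (shrunk_column b w l))\<^sup>2)
    = (1 - b\<^sup>2) / real CARD('b) * (norm (row_sums w))\<^sup>2 + b\<^sup>2 * (norm w)\<^sup>2"
proof -
  have "(\<Sum>l\<in>UNIV. (norm (shrunk_column b w l))\<^sup>2) = (\<Sum>k\<in>UNIV. \<Sum>l\<in>UNIV.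
      ((1 - b) / real CARD('b) * (\<Sum>l\<in>UNIV. w $ (k, l)) + b * w $ (k, l))\<^sup>2)"
    unfolding norm_power2_cart by (subst sum.swap) (simp add: shrunk_column_def row_sums_def)
  also have "\<dots> = (1 - b\<^sup>2) / real CARD('b) * (norm (row_sums w))\<^sup>2 + b\<^sup>2 * (norm w)\<^sup>2"
    unfolding sum_shrunk_power2
    by (simp only: sum.distrib norm_power2_prod norm_power2_cart[where 'r = 'a] row_sums_def
        vec_lambda_beta flip: sum_distrib_left)
  finally show ?thesis .
qed

text \<open>The entry sums of the shrunken columns are the column sums of \<open>w\<close>, shrunk
  by the same factor about their mean.\<close>

lemma sum_inner_shrunk_column:
  fixes w :: "real ^ ('a::finite \<times> 'b::finite)"
  shows "(\<Sum>l\<in>UNIV. (vec 1 \<bullet> shrunk_column b w l)\<^sup>2)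
    = (1 - b\<^sup>2) / real CARD('b) * (vec 1 \<bullet> w)\<^sup>2 + b\<^sup>2 * (norm (row_sums (swap_index w)))\<^sup>2"
proof -
  define h where "h l = (\<Sum>k\<in>UNIV. w $ (k, l))" for l
  have h: "sum h UNIV = vec 1 \<bullet> w"
    unfolding h_def vec1_inner_prod by (rule sum.swap)
  have "vec 1 \<bullet> shrunk_column b w l = (1 - b) / real CARD('b) * sum h UNIV + b * h l" for l
    unfolding h vec1_inner_row_sums[symmetric] unfolding vec1_inner
    by (simp add: shrunk_column_def sum.distrib h_def sum_distrib_left)
  moreover have "(norm (row_sums (swap_index w)))\<^sup>2 = (\<Sum>l\<in>UNIV. (h l)\<^sup>2)"
    by (simp add: norm_power2_cart row_sums_swap_index h_def)
  ultimately show ?thesis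
    using sum_shrunk_power2[of b h] by (simp only: h)
qed

lemma kronecker_dual_cone_norm:
  fixes U1 :: "real ^ 'r1 ^ 'n1" and U2 :: "real ^ 'r2 ^ 'n2"
  assumes U1: "SSC U1" and w: "w \<in> dual_cone (transpose (U1 \<otimes>\<^sub>K U2))"
    and b: "shrunk_simplex_bound b (dual_cone (transpose U2))"
  shows "(1 - b\<^sup>2) * (norm (row_sums w))\<^sup>2 + b\<^sup>2 * real CARD('r2) * (norm w)\<^sup>2
    \<le> (1 - b\<^sup>2) * (vec 1 \<bullet> w)\<^sup>2 + b\<^sup>2 * real CARD('r2) * (norm (row_sums (swap_index w)))\<^sup>2"
proof -
  have "(\<Sum>l\<in>UNIV. (norm (shrunk_column b w l))\<^sup>2) \<le> (\<Sum>l\<in>UNIV. (vec 1 \<bullet> shrunk_column b w l)\<^sup>2)"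
    using SSC_dual_cone_norm_le[OF U1 shrunk_column_dual_cone[OF w b]]
    by (intro sum_mono power_mono) auto
  from mult_left_mono[OF this, of "real CARD('r2)"] show ?thesis
    by (simp add: sum_norm_shrunk_column sum_inner_shrunk_column distrib_left mult_ac)
qed

text \<open>Under these equalities the summed inequality for the shrunken columns is tight, hence
  tight for every column, and SSC2 makes each one a nonnegative multiple of a basis vector. The row
  sums are supported on a single index \<open>k\<close> as well. In any other row the nonnegative
  shrunken entries add up to zero, so they vanish, and so does that row of \<open>w\<close>.\<close>

lemma kronecker_dual_cone_norm_eq:
  fixes U1 :: "real ^ 'r1 ^ 'n1" and U2 :: "real ^ 'r2 ^ 'n2"
  assumes U1: "SSC U1" and U2: "SSC U2" and w: "w \<in> dual_cone (transpose (U1 \<otimes>\<^sub>K U2))"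
    and b0: "0 < b" and b: "shrunk_simplex_bound b (dual_cone (transpose U2))"
    and eq: "norm w = vec 1 \<bullet> w" "norm (row_sums w) = vec 1 \<bullet> w"
      "norm (row_sums (swap_index w)) = vec 1 \<bullet> w"
  obtains k where "\<And>k' l. k' \<noteq> k \<Longrightarrow> w $ (k', l) = 0"
proof -
  have c: "shrunk_column b w l \<in> dual_cone (transpose U1)" for l
    using shrunk_column_dual_cone[OF w b] .
  have le: "norm (shrunk_column b w l) \<le> vec 1 \<bullet> shrunk_column b w l" for l
    by (rule SSC_dual_cone_norm_le[OF U1 c])
  have "(\<Sum>l\<in>UNIV. (vec 1 \<bullet> shrunk_column b w l)\<^sup>2 - (norm (shrunk_column b w l))\<^sup>2) = 0"
    by (simp add: sum_subtractf sum_norm_shrunk_column sum_inner_shrunk_column eq)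
  then have "(vec 1 \<bullet> shrunk_column b w l)\<^sup>2 - (norm (shrunk_column b w l))\<^sup>2 = 0" for l
    by (subst (asm) sum_nonneg_eq_0_iff) (use le in \<open>auto intro: power_mono\<close>)
  then have "norm (shrunk_column b w l) = vec 1 \<bullet> shrunk_column b w l" for l
    using order_trans[OF norm_ge_zero le[of l]]
    by (metis norm_ge_zero power2_eq_imp_eq right_minus_eq)
  then have c0: "0 \<le> shrunk_column b w l $ k" for k l
    by (rule SSC_dual_cone_norm_eq[OF U1 c[of l]]) (auto simp: axis_def)
  have "norm (row_sums w) = vec 1 \<bullet> row_sums w"
    by (simp add: eq vec1_inner_row_sums)
  then obtain t k where k: "row_sums w = t *\<^sub>R axis k 1"
    using SSC_dual_cone_norm_eq[OF U1 row_sums_dual_cone[OF w U2]] by metis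
  have "w $ (k', l) = 0" if "k' \<noteq> k" for k' l
  proof -
    have r0: "row_sums w $ k' = 0"
      using that by (simp add: k axis_def)
    then have "(\<Sum>l\<in>UNIV. shrunk_column b w l $ k') = b * row_sums w $ k'"
      by (simp add: shrunk_column_def row_sums_def flip: sum_distrib_left)
    then have "shrunk_column b w l $ k' = 0"
      by (subst (asm) r0) (use c0 in \<open>simp add: sum_nonneg_eq_0_iff\<close>)
    then show ?thesis
      using b0 by (simp add: shrunk_column_def r0)
  qed
  with that show thesis
    by blast
qed

section \<open>The scalar inequalities\<close>

text \<open>If a factor is 1, the left side is zero. Otherwise \<open>1 + a < a * r1\<close> and
  \<open>1 + b < b * r2\<close>, while \<open>1 \<le> a + b\<close> amounts to
  \<open>(1 - a) * (1 - b) \<le> a * b\<close>; multiply the three.\<close>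

lemma shrink_factors_less:
  fixes a b :: real
  assumes a: "0 < a" "a \<le> 1" "a = 1 \<or> 1 < a * (r1 - 1)" and r1: "0 < r1"
    and b: "0 < b" "b \<le> 1" "b = 1 \<or> 1 < b * (r2 - 1)" and r2: "0 < r2"
    and ab: "1 \<le> a + b"
  shows "(1 - b\<^sup>2) * (1 - a\<^sup>2) < (b\<^sup>2 * r2) * (a\<^sup>2 * r1)"
proof (cases "a = 1 \<or> b = 1")
  case True
  then show ?thesis
    using a b r1 r2 by auto
next
  case False
  have "(1 + a) * (1 + b) < (a * r1) * (b * r2)"
    using a b False by (intro mult_strict_mono) (auto simp: algebra_simps)
  then have "(a * b) * ((1 + a) * (1 + b)) < (a * b) * ((a * r1) * (b * r2))"
    using a b by simp
  moreover have "((1 - a) * (1 - b)) * ((1 + a) * (1 + b)) \<le> (a * b) * ((1 + a) * (1 + b))"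
    using a b ab by (intro mult_right_mono) (auto simp: algebra_simps)
  ultimately show ?thesis
    by (simp add: power2_eq_square algebra_simps)
qed

text \<open>Adding \<open>Q\<close> times the first inequality to \<open>u\<close> times the second
  eliminates \<open>F\<close> and leaves
  \<open>(P * Q - u * v) * G \<le> (P * Q + u * Q) * X\<close>, with both coefficients
  positive.\<close>

lemma cross_bounds:
  fixes F G X :: real
  assumes "0 \<le> F" "0 \<le> G" "0 < P" "0 < Q" "0 \<le> u" "0 \<le> v" "u * v < P * Q"
    and 1: "P * G \<le> P * X + u * F" and 2: "Q * F \<le> Q * X + v * G"
  shows "0 \<le> X" "X = 0 \<Longrightarrow> G = 0"
proof -
  have "Q * (P * G) \<le> Q * (P * X + u * F)" "u * (Q * F) \<le> u * (Q * X + v * G)"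
    using assms by (auto intro: mult_left_mono)
  then have *: "(P * Q - u * v) * G \<le> (P * Q + u * Q) * X"
    by (simp add: algebra_simps)
  have "0 < P * Q + u * Q"
    using assms by (simp add: add_pos_nonneg)
  moreover have "0 \<le> (P * Q - u * v) * G"
    using assms by simp
  ultimately show "0 \<le> X"
    using * by (metis order_trans zero_le_mult_iff not_less)
  show "G = 0" if "X = 0"
    using * that assms by (simp add: mult_le_0_iff)
qed

section \<open>Assembly of SSC1 and SSC2 for the Kronecker product\<close>

theorem theorem7p4:
  fixes U1 :: "real ^ 'r1 ^ 'n1" and U2 :: "real ^ 'r2 ^ 'n2"
    and p1 p2 :: real
  assumes "SSC U1" and "pSSC p1 U1"
    and "SSC U2" and "pSSC p2 U2"
    and "1 \<le> sqrt ((real CARD('r1) - p1\<^sup>2) / (p1\<^sup>2 * (real CARD('r1) - 1)))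
           + sqrt ((real CARD('r2) - p2\<^sup>2) / (p2\<^sup>2 * (real CARD('r2) - 1)))"
  shows "SSC (U1 \<otimes>\<^sub>K U2)"
proof -
  define D where "D = dual_cone (transpose (U1 \<otimes>\<^sub>K U2))"
  have r: "2 \<le> CARD('r1)" "2 \<le> CARD('r2)"
    using assms by (simp_all add: SSC_def)
  define A where "A = sqrt ((real CARD('r1) - p1\<^sup>2) / (p1\<^sup>2 * (real CARD('r1) - 1)))"
  define B where "B = sqrt ((real CARD('r2) - p2\<^sup>2) / (p2\<^sup>2 * (real CARD('r2) - 1)))"
  have AB: "1 \<le> A + B" "A \<le> 1" "B \<le> 1"
    using assms pSSC_shrink_factor_le_1 unfolding A_def B_def by auto
  \<comment> \<open>Both \<open>A\<close> and \<open>B\<close> are nonnegative: they sum to at least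
    1 and neither exceeds 1.\<close>
  have "p1\<^sup>2 \<le> real CARD('r1)"
    using AB by (intro pSSC_power2_le_card[OF assms(2)]) (simp flip: A_def)
  then obtain a where a: "0 < a" "a \<le> 1" "a = 1 \<or> 1 < a * (real CARD('r1) - 1)" "A \<le> a"
    "shrunk_simplex_bound a (dual_cone (transpose U1))"
    using SSC_pSSC_shrunk_simplex_bound[OF assms(1,2)] unfolding A_def by metis
  have "p2\<^sup>2 \<le> real CARD('r2)"
    using AB by (intro pSSC_power2_le_card[OF assms(4)]) (simp flip: B_def)
  then obtain b where b: "0 < b" "b \<le> 1" "b = 1 \<or> 1 < b * (real CARD('r2) - 1)" "B \<le> b"
    "shrunk_simplex_bound b (dual_cone (transpose U2))"
    using SSC_pSSC_shrunk_simplex_bound[OF assms(3,4)] unfolding B_def by metis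
  have factors: "(1 - b\<^sup>2) * (1 - a\<^sup>2) < (b\<^sup>2 * real CARD('r2)) * (a\<^sup>2 * real CARD('r1))"
    using a b AB by (intro shrink_factors_less) auto
  have r12: "2 \<le> CARD('r1 \<times> 'r2)"
    using r mult_le_mono[of 2 "CARD('r1)" 1 "CARD('r2)"] by simp
  have nonneg: "nonneg_matrix (U1 \<otimes>\<^sub>K U2)"
    using assms(1,3) by (simp add: SSC_def nonneg_matrix_def kronecker_def)
  have dual: "norm w \<le> vec 1 \<bullet> w" "norm w = vec 1 \<bullet> w \<Longrightarrow> norm (row_sums w) = vec 1 \<bullet> w"
    "norm w = vec 1 \<bullet> w \<Longrightarrow> norm (row_sums (swap_index w)) = vec 1 \<bullet> w" if w: "w \<in> D" for w
  proof -
    define s where "s = vec 1 \<bullet> w"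
    define F where "F = s\<^sup>2 - (norm (row_sums w))\<^sup>2"
    define G where "G = s\<^sup>2 - (norm (row_sums (swap_index w)))\<^sup>2"
    define X where "X = s\<^sup>2 - (norm w)\<^sup>2"
    have w': "swap_index w \<in> dual_cone (transpose (U2 \<otimes>\<^sub>K U1))"
      using w swap_index_dual_cone by (simp add: D_def)
    have f: "norm (row_sums w) \<le> s"
      using SSC_dual_cone_norm_le[OF assms(1) row_sums_dual_cone[OF w[unfolded D_def] assms(3)]]
      by (simp add: vec1_inner_row_sums s_def)
    have g: "norm (row_sums (swap_index w)) \<le> s"
      using SSC_dual_cone_norm_le[OF assms(3) row_sums_dual_cone[OF w' assms(1)]]
      by (simp add: vec1_inner_row_sums vec1_inner_swap_index s_def)
    have s0: "0 \<le> s"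
      using order_trans[OF norm_ge_zero f] .
    have FG: "0 \<le> F" "0 \<le> G"
      using f g by (simp_all add: F_def G_def power_mono)
    have PQ: "0 < b\<^sup>2 * real CARD('r2)" "0 < a\<^sup>2 * real CARD('r1)" "0 \<le> 1 - b\<^sup>2" "0 \<le> 1 - a\<^sup>2"
      using a b by (simp_all add: power_le_one)
    have 1: "b\<^sup>2 * real CARD('r2) * G \<le> b\<^sup>2 * real CARD('r2) * X + (1 - b\<^sup>2) * F"
      using kronecker_dual_cone_norm[OF assms(1) w[unfolded D_def] b(5)]
      by (simp add: F_def G_def X_def right_diff_distrib flip: s_def)
    have "swap_index (swap_index w) = w"
      by (simp add: swap_index_def)
    then have 2: "a\<^sup>2 * real CARD('r1) * F \<le> a\<^sup>2 * real CARD('r1) * X + (1 - a\<^sup>2) * G"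
      using kronecker_dual_cone_norm[OF assms(3) w' a(5)]
      by (simp add: F_def G_def X_def right_diff_distrib vec1_inner_swap_index norm_swap_index flip: s_def)
    \<comment> \<open>The first instance gives \<open>0 \<le> X\<close>, and \<open>G = 0\<close>
      when \<open>X = 0\<close>; the second, with the two factors exchanged, gives
      \<open>F = 0\<close> when \<open>X = 0\<close>.\<close>
    note X1 = cross_bounds[OF FG PQ(1,2,3,4) factors 1 2]
    note X2 = cross_bounds[OF FG(2,1) PQ(2,1,4,3) _ 2 1]
    show "norm w \<le> vec 1 \<bullet> w"
      using X1(1) s0 by (intro power2_le_imp_le[of "norm w"]) (auto simp: X_def s_def)
    assume "norm w = vec 1 \<bullet> w"
    then have "X = 0"
      by (simp add: X_def s_def)
    then have "F = 0" "G = 0"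
      using X1(2) X2(2) factors by (simp_all add: mult.commute)
    then show "norm (row_sums w) = vec 1 \<bullet> w" "norm (row_sums (swap_index w)) = vec 1 \<bullet> w"
      using s0 by (simp_all add: F_def G_def power2_eq_iff_nonneg flip: s_def)
  qed
  have SSC1: "SSC1 (U1 \<otimes>\<^sub>K U2)"
    unfolding SSC1_def
  proof
    fix x :: "real ^ ('r1 \<times> 'r2)" assume x: "x \<in> C_set (sqrt (real CARD('r1 \<times> 'r2) - 1))"
    show "x \<in> conic_image (transpose (U1 \<otimes>\<^sub>K U2))"
    \<comment> \<open>The dual cone lies in \<open>C_star\<close>, on which every element of
      \<open>C_set\<close> is nonnegative.\<close>
    proof (rule farkas)
      fix w assume "w \<in> dual_cone (transpose (U1 \<otimes>\<^sub>K U2))"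
      then have "w \<in> C_star"
        using dual(1) by (simp add: C_star_def D_def)
      then show "0 \<le> x \<bullet> w"
        using C_set_inner_C_star r12 x by blast
    qed
  qed
  have axis: "\<exists>l k. w = l *\<^sub>R axis k 1 \<and> 0 \<le> l" if w: "w \<in> D" and nw: "norm w = vec 1 \<bullet> w" for w
  proof -
    have w': "swap_index w \<in> dual_cone (transpose (U2 \<otimes>\<^sub>K U1))"
      using w swap_index_dual_cone by (simp add: D_def)
    \<comment> \<open>Equality confines \<open>w\<close> to one row; the same argument for the
      transpose confines it to one column, leaving a single entry.\<close>
    obtain i where i: "\<And>k l. k \<noteq> i \<Longrightarrow> w $ (k, l) = 0"
      using kronecker_dual_cone_norm_eq[OF assms(1,3) w[unfolded D_def] b(1,5) nw dual(2,3)[OF w nw]]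
      by metis
    have "swap_index (swap_index w) = w"
      by (simp add: swap_index_def)
    then obtain j where j: "\<And>l k. l \<noteq> j \<Longrightarrow> swap_index w $ (l, k) = 0"
      using kronecker_dual_cone_norm_eq[OF assms(3,1) w' a(1,5)] nw dual(2,3)[OF w nw]
      by (metis vec1_inner_swap_index norm_swap_index)
    define c where "c = w $ (i, j)"
    have c: "w = c *\<^sub>R axis (i, j) 1"
      using i j by (auto simp: c_def vec_eq_iff axis_def swap_index_def)
    have "vec 1 \<bullet> w = c"
      by (subst c) (simp add: inner_axis)
    then have "0 \<le> c"
      using nw norm_ge_zero[of w] by simp
    with c show ?thesis
      by blast
  qed
  have "SSC2 (U1 \<otimes>\<^sub>K U2)"
    unfolding SSC2_def frontier_C_star[OF r12]
  proof (intro subset_antisym subsetI)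
    fix w assume "w \<in> dual_cone (transpose (U1 \<otimes>\<^sub>K U2)) \<inter> {x. vec 1 \<bullet> x = norm x}"
    then show "w \<in> {l *\<^sub>R axis k 1 | l k. 0 \<le> l}"
      using axis[of w] by (simp add: D_def)
  next
    fix w :: "real ^ ('r1 \<times> 'r2)" assume "w \<in> {l *\<^sub>R axis k 1 | l k. 0 \<le> l}"
    then obtain l k where w: "w = l *\<^sub>R axis k 1" "0 \<le> l"
      by blast
    \<comment> \<open>Pairing a basis vector with the rows picks out a column of the Kronecker
      product, whose entries are nonnegative.\<close>
    have "axis k 1 \<in> dual_cone (transpose (U1 \<otimes>\<^sub>K U2))"
      using nonneg unfolding mem_dual_cone_transpose
      by (cases k) (simp add: nonneg_matrix_def axis_def if_distrib cong: if_cong)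
    then show "w \<in> dual_cone (transpose (U1 \<otimes>\<^sub>K U2)) \<inter> {x. vec 1 \<bullet> x = norm x}"
      using w scaleR_dual_cone by (simp add: inner_axis)
  qed
  then show ?thesis
    using r12 nonneg SSC1 by (simp add: SSC_def)
qed

end
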